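(* Let $L$ be an odd positive integer and let $B_L\Theta$ be the degree-$L$ Bernstein polynomial approximation of the step function $\Theta$. Then: (i) $B_L\Theta$ is monotonically increasing in $[0,1]$. (ii) $(B_L\Theta)(x)+(B_L\Theta)(1-x)=1$ for all $x\in\mathbb{R}$. (iii) $B_L\Theta\in\mathcal{P}$ if and only if $L\equiv 1\pmod 4$.
   Context: $G:=[0,1]$. The step function $\Theta$ on $G$ is $\Theta(x)=0$ for $x<1/2$, $\Theta(1/2)=1/2$, $\Theta(x)=1$ for $x>1/2$. Its degree-$L$ Bernstein polynomial approximation is $$(B_L\Theta)(x):=\sum_{k=0}^{L}\Theta\left(\frac{k}{L}\right)\binom{L}{k}x^k(1-x)^{L-k},\quad x\in\mathbb{R}.$$ $\mathcal{P}$ is the set of real-valued univariate polynomials $p$ satisfying: $p(x)\in[0,1]$ for all $x\in G$; $p(x)\le 0$ for all $x\le 0$; $p(x)\ge 1$ for all $x\ge 1$. *)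

theory Defs
  imports "HOL-Analysis.Analysis"
begin

(* The step function on [0,1]. Its values outside [0,1] are never used. *)
definition step_fun :: "real \<Rightarrow> real" where
  "step_fun x = (if x < 1/2 then 0 else if x = 1/2 then 1/2 else 1)"

(* Bernstein L k x = (L choose k) * x^k * (1 - x)^(L - k), taken for all real x.
   Since k / 0 = 0, the value for L = 0 is the constant f 0. *)
definition bernstein_approx :: "nat \<Rightarrow> (real \<Rightarrow> real) \<Rightarrow> real \<Rightarrow> real" where
  "bernstein_approx L f x = (\<Sum>k=0..L. f (real k / real L) * Bernstein L k x)"

(* Univariate real polynomials are represented by the functions they induce on the
   whole real line; over the reals a polynomial and its function determine each other. *)
definition step_polys :: "(real \<Rightarrow> real) set" where
  "step_polys = {p. real_polynomial_function p \<and>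
     (\<forall>x\<in>{0..1}. p x \<in> {0..1}) \<and> (\<forall>x\<le>0. p x \<le> 0) \<and> (\<forall>x\<ge>1. p x \<ge> 1)}"

end

theory Submission
  imports Defs
begin

text \<open>
  Write \<open>L = 2 * m + 1\<close>. As \<open>L\<close> is odd, no node \<open>k / L\<close> equals \<open>1/2\<close>, so the approximation is
  the upper half \<open>\<Sum>k=m+1..2*m+1. Bernstein L k\<close> of the Bernstein basis. The reflection
  \<open>x \<mapsto> 1 - x\<close> turns it into the lower half, and the basis is a partition of unity: this is the
  symmetry.

  Everything else is read off from the derivative. Differentiating a tail of the Bernstein basis
  gives a telescoping sum, of which a single term survives
  (\<open>Bernstein_tail_has_derivative\<close>); here it is a positive multiple of \<open>(x * (1 - x)) ^ m\<close>.
  It is nonnegative on the unit interval, which gives monotonicity there. If \<open>m\<close> is even, that is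
  \<open>L mod 4 = 1\<close>, it is nonnegative on the whole line; the approximation is then increasing
  everywhere, and its values \<open>0\<close> at \<open>0\<close> and \<open>1\<close> at \<open>1\<close> yield all the required bounds. If \<open>m\<close> is
  odd, the derivative is negative to the left of \<open>0\<close>; so the approximation is positive there, which
  the definition of \<open>step_polys\<close> forbids.
\<close>

lemma Bernstein_reflect:
  assumes "k \<le> n"
  shows "Bernstein n k (1 - x) = Bernstein n (n - k) x"
  using assms by (simp add: Bernstein_def binomial_symmetric[of k n])

lemma Bernstein_has_derivative:
  assumes "k \<le> n"
  shows "(Bernstein (Suc n) (Suc k) has_real_derivative
    real (Suc n) * (Bernstein n k x - Bernstein n (Suc k) x)) (at x)"
proof -
  have a: "real (Suc n choose Suc k) * (1 + real k) = real (Suc n) * real (n choose k)"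
    using Suc_times_binomial[of k n] by (metis mult.commute of_nat_Suc of_nat_mult)
  have b: "real (Suc n choose Suc k) * real (n - k) = real (Suc n) * real (n choose Suc k)"
    using binomial_absorb_comp[of "Suc n" "Suc k"]
    by (metis diff_Suc_1 diff_Suc_Suc mult.commute of_nat_mult)
  have D: "((\<lambda>x. real (Suc n choose Suc k) * x ^ Suc k * (1 - x) ^ (n - k)) has_real_derivative
      real (Suc n choose Suc k) * (1 + real k) * (x ^ k * (1 - x) ^ (n - k))
      - real (Suc n choose Suc k) * real (n - k) * (x ^ Suc k * (1 - x) ^ (n - Suc k))) (at x)"
    by (rule derivative_eq_intros refl)+ (simp add: algebra_simps del: binomial_Suc_Suc)
  show ?thesis
    using D unfolding a b by (simp add: Bernstein_def[abs_def] algebra_simps del: binomial_Suc_Suc)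
qed

text \<open>
  The analytic core: in probabilistic terms, the upper tail of a binomial distribution, as a
  function of the success probability, has a beta density as its derivative.
\<close>

lemma Bernstein_tail_has_derivative:
  assumes "j \<le> n"
  shows "((\<lambda>x. \<Sum>k=j..n. Bernstein (Suc n) (Suc k) x) has_real_derivative
    real (Suc n) * Bernstein n j x) (at x)"
proof -
  have "(\<Sum>k=j..n. real (Suc n) * (Bernstein n k x - Bernstein n (Suc k) x))
      = real (Suc n) * (Bernstein n j x - Bernstein n (Suc n) x)"
    using sum_Suc_diff[of j n "\<lambda>k. - Bernstein n k x"] assms
    by (simp add: sum_distrib_left[symmetric])
  also have "Bernstein n (Suc n) x = 0"
    by (simp add: Bernstein_def)
  finally have "(\<Sum>k=j..n. real (Suc n) * (Bernstein n k x - Bernstein n (Suc k) x))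
      = real (Suc n) * Bernstein n j x"
    by simp
  moreover have "((\<lambda>x. \<Sum>k=j..n. Bernstein (Suc n) (Suc k) x) has_real_derivative
      (\<Sum>k=j..n. real (Suc n) * (Bernstein n k x - Bernstein n (Suc k) x))) (at x)"
    by (intro DERIV_sum Bernstein_has_derivative) simp
  ultimately show ?thesis
    by simp
qed

lemma step_fun_odd_node:
  "step_fun (real k / real (2 * m + 1)) = (if k \<le> m then 0 else 1)"
proof (cases "k \<le> m")
  case True
  then have "real k / real (2 * m + 1) < 1 / 2"
    by (simp add: field_simps)
  then show ?thesis
    using True by (simp add: step_fun_def)
next
  case False
  then have "real k / real (2 * m + 1) > 1 / 2"
    by (simp add: field_simps)
  then show ?thesis
    using False by (simp add: step_fun_def)
qed

lemma bernstein_approx_step_odd: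
  "bernstein_approx (2 * m + 1) step_fun x
    = (\<Sum>k=m+1..2*m+1. Bernstein (2 * m + 1) k x)"
  unfolding bernstein_approx_def step_fun_odd_node
  by (rule sum.mono_neutral_cong_right) auto

lemma bernstein_approx_step_has_derivative:
  "(bernstein_approx (2 * m + 1) step_fun has_real_derivative
    real (2 * m + 1) * real (2 * m choose m) * (x * (1 - x)) ^ m) (at x)"
proof -
  have "bernstein_approx (2 * m + 1) step_fun
      = (\<lambda>x. \<Sum>k=m..2*m. Bernstein (Suc (2 * m)) (Suc k) x)"
  proof
    fix x
    show "bernstein_approx (2 * m + 1) step_fun x
        = (\<Sum>k=m..2*m. Bernstein (Suc (2 * m)) (Suc k) x)"
      unfolding bernstein_approx_step_odd
      using sum.shift_bounds_cl_Suc_ivl[of "\<lambda>k. Bernstein (2 * m + 1) k x" m "2 * m"] by simp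
  qed
  moreover have "real (Suc (2 * m)) * Bernstein (2 * m) m x
      = real (2 * m + 1) * real (2 * m choose m) * (x * (1 - x)) ^ m"
    by (simp add: Bernstein_def power_mult_distrib)
  ultimately show ?thesis
    using Bernstein_tail_has_derivative[of m "2 * m" x] by (metis le_add1 mult_2)
qed

lemma bernstein_approx_step_symmetry:
  "bernstein_approx (2 * m + 1) step_fun x + bernstein_approx (2 * m + 1) step_fun (1 - x) = 1"
proof -
  let ?B = "\<lambda>k. Bernstein (2 * m + 1) k x"
  have "bernstein_approx (2 * m + 1) step_fun (1 - x)
      = (\<Sum>k=m+1..2*m+1. ?B (2 * m + 1 - k))"
    unfolding bernstein_approx_step_odd by (intro sum.cong refl Bernstein_reflect) simp
  also have "\<dots> = (\<Sum>k=0..m. ?B k)"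
    by (rule sum.reindex_bij_witness[of _ "\<lambda>k. 2 * m + 1 - k" "\<lambda>k. 2 * m + 1 - k"]) auto
  finally have "bernstein_approx (2 * m + 1) step_fun x
        + bernstein_approx (2 * m + 1) step_fun (1 - x)
      = (\<Sum>k=0..m. ?B k) + (\<Sum>k=m+1..2*m+1. ?B k)"
    using bernstein_approx_step_odd[of m x] by linarith
  also have "\<dots> = (\<Sum>k\<le>2*m+1. ?B k)"
    using sum.ub_add_nat[of 0 m ?B "m + 1"] by (simp add: atMost_atLeast0 mult_2)
  also have "\<dots> = 1"
    by (rule sum_Bernstein)
  finally show ?thesis .
qed

lemma bernstein_approx_step_0: "bernstein_approx (2 * m + 1) step_fun 0 = 0"
  unfolding bernstein_approx_step_odd by (intro sum.neutral) (auto simp: Bernstein_def)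

lemma bernstein_approx_step_1: "bernstein_approx (2 * m + 1) step_fun 1 = 1"
  using bernstein_approx_step_symmetry[of m 0] bernstein_approx_step_0[of m] by simp

lemma real_polynomial_function_bernstein_approx:
  "real_polynomial_function (bernstein_approx n f)"
  unfolding bernstein_approx_def[abs_def] Bernstein_def[abs_def]
  by (intro real_polynomial_function_sum real_polynomial_function.intros
      real_polynomial_function_power real_polynomial_function_diff) auto

lemma mono_on_bernstein_approx_step:
  "mono_on {0..1} (bernstein_approx (2 * m + 1) step_fun)"
proof (rule mono_onI)
  fix x y :: real
  assume "x \<in> {0..1}" "y \<in> {0..1}" "x \<le> y"
  moreover have "real (2 * m + 1) * real (2 * m choose m) * (t * (1 - t)) ^ m \<ge> 0"
    if "x \<le> t" "t \<le> y" for t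
    using that \<open>x \<in> {0..1}\<close> \<open>y \<in> {0..1}\<close> by (intro mult_nonneg_nonneg zero_le_power) auto
  ultimately show "bernstein_approx (2 * m + 1) step_fun x
      \<le> bernstein_approx (2 * m + 1) step_fun y"
    using bernstein_approx_step_has_derivative by (blast intro: DERIV_nonneg_imp_nondecreasing)
qed

lemma mono_bernstein_approx_step:
  assumes "even m"
  shows "mono (bernstein_approx (2 * m + 1) step_fun)"
proof (rule monoI)
  fix x y :: real
  assume "x \<le> y"
  moreover have "real (2 * m + 1) * real (2 * m choose m) * (t * (1 - t)) ^ m \<ge> 0" for t :: real
    using assms by (intro mult_nonneg_nonneg zero_le_even_power) auto
  ultimately show "bernstein_approx (2 * m + 1) step_fun x
      \<le> bernstein_approx (2 * m + 1) step_fun y"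
    using bernstein_approx_step_has_derivative by (blast intro: DERIV_nonneg_imp_nondecreasing)
qed

lemma bernstein_approx_step_pos_left:
  assumes "odd m" and "x < 0"
  shows "bernstein_approx (2 * m + 1) step_fun x > 0"
proof -
  let ?f = "bernstein_approx (2 * m + 1) step_fun"
  have "?f x > ?f 0"
  proof (rule DERIV_neg_imp_decreasing_open[where f = ?f])
    show "x < 0" by (rule assms)
    show "\<exists>y. DERIV ?f t :> y \<and> y < 0" if "x < t" and "t < 0" for t
    proof (intro exI conjI)
      show "DERIV ?f t :> real (2 * m + 1) * real (2 * m choose m) * (t * (1 - t)) ^ m"
        by (rule bernstein_approx_step_has_derivative)
      have "(t * (1 - t)) ^ m < 0"
        using that \<open>odd m\<close> by (simp add: power_less_zero_eq mult_less_0_iff)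
      then show "real (2 * m + 1) * real (2 * m choose m) * (t * (1 - t)) ^ m < 0"
        by (intro mult_pos_neg mult_pos_pos) simp_all
    qed
    show "continuous_on {x..0} ?f"
      by (rule DERIV_continuous_on[OF has_field_derivative_at_within,
            OF bernstein_approx_step_has_derivative])
  qed
  then show ?thesis
    using bernstein_approx_step_0[of m] by simp
qed

theorem lemma3p1:
  fixes L :: nat
  assumes "L > 0" and "odd L"
  shows "mono_on {0..1} (bernstein_approx L step_fun)
    \<and> (\<forall>x::real. bernstein_approx L step_fun x + bernstein_approx L step_fun (1 - x) = 1)
    \<and> (bernstein_approx L step_fun \<in> step_polys \<longleftrightarrow> L mod 4 = 1)"
proof -
  obtain m where L: "L = 2 * m + 1"
    using \<open>odd L\<close> by (rule oddE)
  let ?f = "bernstein_approx (2 * m + 1) step_fun"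
  have "L mod 4 = 1 \<longleftrightarrow> even m"
    unfolding L by presburger
  moreover have "?f \<in> step_polys" if "even m"
  proof -
    have "mono ?f"
      using that by (rule mono_bernstein_approx_step)
    then have "?f x \<le> ?f y" if "x \<le> y" for x y
      using that by (rule monoD)
    then have "0 \<le> x \<Longrightarrow> 0 \<le> ?f x" "x \<le> 0 \<Longrightarrow> ?f x \<le> 0"
        "x \<le> 1 \<Longrightarrow> ?f x \<le> 1" "1 \<le> x \<Longrightarrow> 1 \<le> ?f x" for x
      by (metis bernstein_approx_step_0 bernstein_approx_step_1)+
    then show ?thesis
      using real_polynomial_function_bernstein_approx[of "2 * m + 1" step_fun]
      unfolding step_polys_def by auto
  qed
  moreover have "?f \<notin> step_polys" if "odd m"
    using bernstein_approx_step_pos_left[OF that, of "-1"]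
    by (auto simp: step_polys_def not_le intro!: exI[of _ "-1"])
  ultimately show ?thesis
    using mono_on_bernstein_approx_step[of m] bernstein_approx_step_symmetry[of m]
    unfolding L by blast
qed

end
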